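(* We have $$\int_0^1\frac{x\,\sin^{-1}\left(\frac{x}{2}\right)\log(x)}{x^2-1}\,dx=\frac{5\pi^3}{1296}$$ and $$\int_0^1\frac{x\,\cos^{-1}\left(\frac{x}{2}\right)\log(x)}{x^2-1}\,dx=\frac{11\pi^3}{648}.$$
   Context: $\sin^{-1}$ and $\cos^{-1}$ denote the principal inverse sine and inverse cosine functions, and $\log$ is the natural logarithm. *)

theory Defs
  imports "HOL-Analysis.Analysis"
begin

end

theory Submission
  imports Defs "HOL-Complex_Analysis.Cauchy_Integral_Formula" "HOL-Real_Asymp.Real_Asymp"
begin

text \<open>
  Since arcsin and arccos add up to \<open>\<pi>/2\<close>, the two integrals add up to \<open>\<pi>/2\<close> times the
  elementary integral of \<open>x ln x / (x\<^sup>2 - 1)\<close>, so it is enough to find the one with arccos.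

  The product \<open>\<theta> ln x\<close> is half the imaginary part of \<open>(Ln w)\<^sup>2\<close> for \<open>w = x e\<^sup>i\<^sup>\<theta>\<close>.  With
  \<open>\<theta> = arccos (x/2)\<close> the point \<open>w\<close> runs, as \<open>x\<close> goes from \<open>0\<close> to \<open>1\<close>, along an arc of the circle
  \<open>|w - 1| = 1\<close> from \<open>0\<close> to \<open>\<rho> = e\<^sup>i\<^sup>\<pi>\<^sup>/\<^sup>3\<close>, and there \<open>(w\<^sup>2 - w + 1)/(w - 1) = x\<^sup>2 - 1\<close>.  Hence
  \<open>2x/(x\<^sup>2 - 1) dx\<close> is the restriction to the arc of the rational form \<open>h(w) dw\<close>, the logarithmic
  differential of \<open>(w\<^sup>2 - w + 1)/(w - 1)\<close>, and four times the arccos integral is the imaginary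
  part of the integral of \<open>(Ln w)\<^sup>2 h(w) dw\<close> over the arc.

  The form \<open>(\<pi>\<^sup>2/9) h(w) dw\<close> is real along the arc and can be added without changing that
  imaginary part.  Because
  \<open>(Ln \<rho>)\<^sup>2 = -\<pi>\<^sup>2/9\<close>, this removes the pole of \<open>h\<close> at \<open>\<rho>\<close>: the form
  \<open>((Ln w)\<^sup>2 + \<pi>\<^sup>2/9) h(w) dw\<close> is holomorphic in the whole upper half plane, \<open>\<rho>\<close> included, and
  has a primitive there (\<open>contour_integrand_primitive\<close>).  At \<open>0\<close> it grows only like \<open>(ln |w|)\<^sup>2\<close>
  (\<open>primitive_gap_bound\<close>).  The arc may therefore be replaced by the straight segment \<open>r \<rho>\<close>,
  \<open>0 < r < 1\<close> (\<open>integral_arc_minus_ray\<close>).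

  On the segment \<open>Ln w = ln r + i\<pi>/3\<close>, and the imaginary part is a combination of \<open>ln r\<close> and
  \<open>(ln r)\<^sup>2\<close> with rational functions of \<open>r\<close> as coefficients whose denominators divide \<open>1 - r\<^sup>6\<close>.
  Expanding these as geometric series leaves two kinds of sums: sums of \<open>1/n\<^sup>2\<close> over residue
  classes, which reduce to the Basel problem, and the sum of \<open>1/(n+1/3)\<^sup>3 - 1/(n+2/3)\<^sup>3\<close>, which is
  a difference of tetragamma values at \<open>1/3\<close> and \<open>2/3\<close> and comes from the reflection formula of
  the Gamma function.
\<close>

section \<open>Logarithmic moments on the unit interval\<close>

lemma has_integral_sums_nonneg:
  fixes f :: "nat \<Rightarrow> real \<Rightarrow> real"
  assumes "\<And>k. (f k has_integral c k) S"
    and "\<And>k x. x \<in> S \<Longrightarrow> 0 \<le> f k x"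
    and "\<And>x. x \<in> S \<Longrightarrow> (\<lambda>k. f k x) sums F x"
    and "c sums C"
  shows "(F has_integral C) S"
proof (rule has_integral_monotone_convergence_increasing)
  show "((\<lambda>x. \<Sum>k<n. f k x) has_integral (\<Sum>k<n. c k)) S" for n
    by (intro has_integral_sum assms) auto
qed (use assms in \<open>auto simp: sums_def\<close>)

text \<open>
  In the proof the antiderivative is rewritten so that \<open>ln x\<close> occurs only in the product
  \<open>x ln x\<close>, which is continuous at \<open>0\<close>; the convention \<open>ln 0 = 0\<close> gives it the limiting value.
\<close>
lemma has_integral_ln_times_power:
  "((\<lambda>x::real. ln x * x ^ k) has_integral - 1 / real (k + 1) ^ 2) {0..1}"
proof -
  define c where "c = real (k + 1)"
  have c: "c > 0" and c_eq: "1 + real k = c" by (simp_all add: c_def)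
  define G where "G x = x ^ Suc k * (ln x / c - 1 / c\<^sup>2)" for x :: real
  have G_alt: "G x = x ^ k * (x * ln x) / c - x ^ Suc k / c\<^sup>2" for x
    by (simp add: G_def algebra_simps)
  have "((\<lambda>x. ln x * x ^ k) has_integral (G 1 - G 0)) {0..1}"
  proof (rule fundamental_theorem_of_calculus_interior)
    have xlnx: "continuous_on {0..1} (\<lambda>x::real. x * ln x)"
      unfolding continuous_on_def
    proof
      fix x :: real assume "x \<in> {0..1}"
      show "((\<lambda>x. x * ln x) \<longlongrightarrow> x * ln x) (at x within {0..1})"
      proof (cases "x = 0")
        case True
        have "((\<lambda>x::real. x * ln x) \<longlongrightarrow> 0) (at_right 0)" by real_asymp
        then show ?thesis using True
          by (simp add: at_within_Icc_at_right)
      next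
        case False
        then show ?thesis using \<open>x \<in> {0..1}\<close> by (intro tendsto_intros) auto
      qed
    qed
    show "continuous_on {0..1} G"
      unfolding G_alt using c by (intro continuous_intros xlnx) auto
  next
    fix x :: real assume x: "x \<in> {0<..<1}"
    have pw: "((\<lambda>x. x ^ Suc k) has_field_derivative c * x ^ k) (at x)"
      by (rule DERIV_cong[OF DERIV_pow]) (simp add: c_def)
    have ln: "(ln has_field_derivative 1 / x) (at x)"
      using x by (intro DERIV_cong[OF DERIV_ln]) (auto simp: inverse_eq_divide)
    have "(G has_field_derivative
        c * x ^ k * (ln x / c - 1 / c\<^sup>2) + x ^ Suc k * (1 / x / c)) (at x)"
      unfolding G_def
      using c x by (auto intro!: derivative_eq_intros pw ln simp: c_eq simp del: power_Suc)
    also have "c * x ^ k * (ln x / c - 1 / c\<^sup>2) + x ^ Suc k * (1 / x / c) = ln x * x ^ k"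
    proof -
      have "c * p * (L / c - 1 / c\<^sup>2) + (x * p) * (1 / x / c) = L * p" for L p
        using x c by (simp add: field_simps power2_eq_square)
      then show ?thesis by simp
    qed
    finally have "(G has_field_derivative ln x * x ^ k) (at x)" .
    then show "(G has_vector_derivative ln x * x ^ k) (at x)"
      by (simp add: has_real_derivative_iff_has_vector_derivative)
  qed auto
  then show ?thesis by (simp add: G_def c_def)
qed

lemma has_integral_ln_squared_times_power:
  "((\<lambda>x::real. (ln x)\<^sup>2 * x ^ k) has_integral 2 / real (k + 1) ^ 3) {0..1}"
proof -
  define c where "c = real (k + 1)"
  have c: "c > 0" and c_eq: "1 + real k = c" by (simp_all add: c_def)
  define G where "G x = x ^ Suc k * ((ln x)\<^sup>2 / c - 2 * ln x / c\<^sup>2 + 2 / c ^ 3)" for x :: real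
  have G_alt: "G x = x ^ k * (x * (ln x)\<^sup>2 / c - 2 * (x * ln x) / c\<^sup>2 + 2 * x / c ^ 3)" for x
    by (simp add: G_def algebra_simps)
  have "((\<lambda>x. (ln x)\<^sup>2 * x ^ k) has_integral (G 1 - G 0)) {0..1}"
  proof (rule fundamental_theorem_of_calculus_interior)
    have xlnx: "continuous_on {0..1} (\<lambda>x::real. x * (ln x)\<^sup>2 / c - 2 * (x * ln x) / c\<^sup>2 + 2 * x / c ^ 3)"
      (is "continuous_on _ ?f")
      unfolding continuous_on_def
    proof
      fix x :: real assume "x \<in> {0..1}"
      show "(?f \<longlongrightarrow> ?f x) (at x within {0..1})"
      proof (cases "x = 0")
        case True
        have "(?f \<longlongrightarrow> 0) (at_right 0)" using c by real_asymp
        then show ?thesis using True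
          by (simp add: at_within_Icc_at_right)
      next
        case False
        then show ?thesis using \<open>x \<in> {0..1}\<close> c by (intro tendsto_intros) auto
      qed
    qed
    show "continuous_on {0..1} G"
      unfolding G_alt by (intro continuous_on_mult xlnx continuous_intros)
  next
    fix x :: real assume x: "x \<in> {0<..<1}"
    have pw: "((\<lambda>x. x ^ Suc k) has_field_derivative c * x ^ k) (at x)"
      by (rule DERIV_cong[OF DERIV_pow]) (simp add: c_def)
    have ln: "(ln has_field_derivative 1 / x) (at x)"
      using x by (intro DERIV_cong[OF DERIV_ln]) (auto simp: inverse_eq_divide)
    have "(G has_field_derivative
        c * x ^ k * ((ln x)\<^sup>2 / c - 2 * ln x / c\<^sup>2 + 2 / c ^ 3) +
        x ^ Suc k * (2 * ln x * (1 / x) / c - 2 * (1 / x) / c\<^sup>2)) (at x)"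
      unfolding G_def using c x
      by (auto intro!: derivative_eq_intros pw ln simp: c_eq power2_eq_square simp del: power_Suc)
    also have "c * x ^ k * ((ln x)\<^sup>2 / c - 2 * ln x / c\<^sup>2 + 2 / c ^ 3) +
        x ^ Suc k * (2 * ln x * (1 / x) / c - 2 * (1 / x) / c\<^sup>2) = (ln x)\<^sup>2 * x ^ k"
    proof -
      \<comment> \<open>Here \<open>i\<close> and \<open>j\<close> stand for \<open>1/c\<close> and \<open>1/x\<close>, which makes the identity polynomial.\<close>
      have "c * p * (L\<^sup>2 * i - 2 * L * i\<^sup>2 + 2 * i ^ 3) +
          (x * p) * (2 * L * j * i - 2 * j * i\<^sup>2) = L\<^sup>2 * p"
        if "c * i = 1" "x * j = 1" for L p i j
        using that by algebra
      from this[of "1 / c" "1 / x"] show ?thesis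
        using x c by (simp add: power_divide)
    qed
    finally have "(G has_field_derivative (ln x)\<^sup>2 * x ^ k) (at x)" .
    then show "(G has_vector_derivative (ln x)\<^sup>2 * x ^ k) (at x)"
      by (simp add: has_real_derivative_iff_has_vector_derivative)
  qed auto
  then show ?thesis by (simp add: G_def c_def)
qed

section \<open>Integrals with one logarithm\<close>

lemma inverse_even_squares_sums: "(\<lambda>n. 1 / (2 * real n + 2)\<^sup>2) sums (pi\<^sup>2 / 24)"
proof -
  have "(\<lambda>n. 1 / 4 * (1 / (real n + 1)\<^sup>2)) sums (1 / 4 * (pi\<^sup>2 / 6))"
    using inverse_squares_sums by (intro sums_mult) (simp add: add_ac)
  moreover have "1 / 4 * (1 / (real n + 1)\<^sup>2) = 1 / (2 * real n + 2)\<^sup>2" for n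
  proof -
    have "(2 * real n + 2)\<^sup>2 = 4 * (real n + 1)\<^sup>2" by (simp add: power2_eq_square algebra_simps)
    then show ?thesis by simp
  qed
  ultimately show ?thesis by simp
qed

lemma inverse_odd_squares_sums: "(\<lambda>n. 1 / (2 * real n + 1)\<^sup>2) sums (pi\<^sup>2 / 8)"
proof -
  have "(\<lambda>n. \<Sum>i\<in>{n * 2..<n * 2 + 2}. 1 / (real i + 1)\<^sup>2) sums (pi\<^sup>2 / 6)"
    using inverse_squares_sums by (intro sums_group) (simp_all add: add_ac)
  moreover have "(\<Sum>i\<in>{n * 2..<n * 2 + 2}. 1 / (real i + 1)\<^sup>2) =
      1 / (2 * real n + 1)\<^sup>2 + 1 / (2 * real n + 2)\<^sup>2" for n
    by (simp add: numeral_2_eq_2 mult.commute add_ac)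
  ultimately have "(\<lambda>n. 1 / (2 * real n + 1)\<^sup>2 + 1 / (2 * real n + 2)\<^sup>2) sums (pi\<^sup>2 / 6)"
    by simp
  from sums_diff[OF this inverse_even_squares_sums] show ?thesis by simp
qed

text \<open>
  The summands \<open>-ln x x\<^sup>a\<^sup>+\<^sup>b\<^sup>n\<close> are nonnegative.  At both endpoints \<open>ln x = 0\<close>, so that the
  expansion, whose geometric series diverges at \<open>x = 1\<close>, is valid on the closed interval.
\<close>
lemma has_integral_ln_times_geometric:
  fixes a b :: nat
  assumes b: "b > 0" and S: "(\<lambda>n. 1 / (real b * real n + real a + 1)\<^sup>2) sums C"
  shows "((\<lambda>x::real. ln x * x ^ a / (1 - x ^ b)) has_integral - C) {0..1}"
proof -
  have "((\<lambda>x::real. - (ln x * x ^ a / (1 - x ^ b))) has_integral C) {0..1}"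
  proof (rule has_integral_sums_nonneg)
    show "((\<lambda>x::real. - (ln x * x ^ (b * n + a))) has_integral
             1 / (real b * real n + real a + 1)\<^sup>2) {0..1}" for n
      using has_integral_neg[OF has_integral_ln_times_power[of "b * n + a"]]
      by (simp add: add_ac)
  next
    fix n and x :: real assume x: "x \<in> {0..1}"
    then have "ln x \<le> 0" by (cases "x = 0") auto
    then show "0 \<le> - (ln x * x ^ (b * n + a))"
      using x by (simp add: mult_nonpos_nonneg)
  next
    fix x :: real assume x: "x \<in> {0..1}"
    show "(\<lambda>n. - (ln x * x ^ (b * n + a))) sums - (ln x * x ^ a / (1 - x ^ b))"
    proof (cases "x = 0 \<or> x = 1")
      case True
      then show ?thesis by auto
    next
      case False
      then have "x ^ b < 1" "x ^ b > 0" using x b by (auto simp: power_less_one_iff)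
      then have "(\<lambda>n. (x ^ b) ^ n) sums (1 / (1 - x ^ b))"
        by (intro geometric_sums) auto
      then have "(\<lambda>n. - ln x * x ^ a * (x ^ b) ^ n) sums (- ln x * x ^ a * (1 / (1 - x ^ b)))"
        by (rule sums_mult)
      moreover have "(\<lambda>n. - (ln x * x ^ (b * n + a))) = (\<lambda>n. - ln x * x ^ a * (x ^ b) ^ n)"
        unfolding power_add power_mult by (simp add: mult_ac)
      ultimately show ?thesis by simp
    qed
  qed (rule S)
  from has_integral_neg[OF this] show ?thesis by simp
qed

lemma integral_x_ln_x:
  "((\<lambda>x::real. x * ln x / (x\<^sup>2 - 1)) has_integral pi\<^sup>2 / 24) {0..1}"
proof -
  have "((\<lambda>x::real. ln x * x ^ 1 / (1 - x ^ 2)) has_integral - (pi\<^sup>2 / 24)) {0..1}"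
    using inverse_even_squares_sums by (intro has_integral_ln_times_geometric) (simp_all add: add_ac)
  note neg = has_integral_neg[OF this]
  have "x * ln x / (x\<^sup>2 - 1) = - (ln x * x ^ 1 / (1 - x ^ 2))" for x :: real
    by (simp add: minus_divide_right mult.commute)
  then show ?thesis using neg by (simp only: minus_minus)
qed

lemma integral_x2_ln_x:
  "((\<lambda>x::real. 3 * (ln x * x\<^sup>2 / (1 - x ^ 6))) has_integral - (pi\<^sup>2 / 24)) {0..1}"
proof -
  have "(\<lambda>n. 1 / 9 * (1 / (2 * real n + 1)\<^sup>2)) sums (1 / 9 * (pi\<^sup>2 / 8))"
    by (intro sums_mult inverse_odd_squares_sums)
  moreover have "1 / 9 * (1 / (2 * real n + 1)\<^sup>2) = 1 / (6 * real n + 2 + 1)\<^sup>2" for n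
  proof -
    have "(6 * real n + 2 + 1)\<^sup>2 = 9 * (2 * real n + 1)\<^sup>2" by (simp add: power2_eq_square algebra_simps)
    then show ?thesis by simp
  qed
  ultimately have "(\<lambda>n. 1 / (real 6 * real n + real 2 + 1)\<^sup>2) sums (pi\<^sup>2 / 72)" by simp
  then have "((\<lambda>x::real. ln x * x ^ 2 / (1 - x ^ 6)) has_integral - (pi\<^sup>2 / 72)) {0..1}"
    by (intro has_integral_ln_times_geometric) simp_all
  from has_integral_mult_right[OF this, of 3] show ?thesis by simp
qed

section \<open>Reflection of the tetragamma function\<close>

lemma ln_Gamma_reflection_real:
  fixes x :: real
  assumes "0 < x" "x < 1"
  shows "ln_Gamma x + ln_Gamma (1 - x) = ln pi - ln (sin (pi * x))"
proof -
  have "complex_of_real (Gamma x * Gamma (1 - x)) = complex_of_real (pi / sin (pi * x))"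
    using Gamma_reflection_complex[of "complex_of_real x"]
    by (simp add: Gamma_complex_of_real [symmetric] sin_of_real [symmetric])
  then have "Gamma x * Gamma (1 - x) = pi / sin (pi * x)" by (simp only: of_real_eq_iff)
  moreover have "sin (pi * x) > 0" using assms by (intro sin_gt_zero) auto
  ultimately show ?thesis
    using assms by (simp add: ln_Gamma_real_pos ln_div flip: ln_mult_pos)
qed

lemma DERIV_unique_on_open:
  fixes f g :: "real \<Rightarrow> real"
  assumes "(f has_field_derivative f') (at x)" "(g has_field_derivative g') (at x)"
    and "open S" "x \<in> S" "\<And>y. y \<in> S \<Longrightarrow> f y = g y"
  shows "f' = g'"
  using has_field_derivative_transform_within_open[OF assms(1,3-5)] assms(2) by (rule DERIV_unique)

text \<open>
  This is the third derivative of the logarithm of \<open>\<Gamma>(x) \<Gamma>(1 - x) = \<pi> / sin (\<pi>x)\<close>.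
\<close>
lemma Polygamma_2_reflection_real:
  fixes x :: real
  assumes x: "0 < x" "x < 1"
  shows "Polygamma 2 x - Polygamma 2 (1 - x) = - 2 * pi ^ 3 * cos (pi * x) / sin (pi * x) ^ 3"
proof -
  have nonpos: "y \<notin> \<int>\<^sub>\<le>\<^sub>0" if "y > 0" for y :: real
    using that by (auto elim!: nonpos_Ints_cases')
  have sin_pos: "sin (pi * y) > 0" if "y \<in> {0<..<1}" for y
    using that by (intro sin_gt_zero) auto
  have 0: "Digamma y - Digamma (1 - y) = - pi * cos (pi * y) / sin (pi * y)" if y: "y \<in> {0<..<1}" for y
  proof (rule DERIV_unique_on_open[OF _ _ open_greaterThanLessThan y])
    show "ln_Gamma z + ln_Gamma (1 - z) = ln pi - ln (sin (pi * z))" if "z \<in> {0<..<1}" for z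
      using that by (intro ln_Gamma_reflection_real) auto
    show "((\<lambda>z. ln_Gamma z + ln_Gamma (1 - z)) has_field_derivative Digamma y - Digamma (1 - y)) (at y)"
      using y by (auto intro!: derivative_eq_intros DERIV_chain2[OF has_field_derivative_ln_Gamma_real])
    show "((\<lambda>z. ln pi - ln (sin (pi * z))) has_field_derivative - pi * cos (pi * y) / sin (pi * y)) (at y)"
      using sin_pos[OF y] by (auto intro!: derivative_eq_intros simp: field_simps)
  qed
  have 1: "Polygamma 1 y + Polygamma 1 (1 - y) = pi\<^sup>2 / sin (pi * y) ^ 2" if y: "y \<in> {0<..<1}" for y
  proof (rule DERIV_unique_on_open[OF _ _ open_greaterThanLessThan y 0])
    show "((\<lambda>z. Digamma z - Digamma (1 - z)) has_field_derivative Polygamma 1 y + Polygamma 1 (1 - y)) (at y)"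
      using y by (auto intro!: derivative_eq_intros nonpos)
    have sc: "sin (pi * y) * sin (pi * y) + cos (pi * y) * cos (pi * y) = 1"
      using sin_cos_squared_add[of "pi * y"] by (simp add: power2_eq_square)
    show "((\<lambda>z. - pi * cos (pi * z) / sin (pi * z)) has_field_derivative pi\<^sup>2 / sin (pi * y) ^ 2) (at y)"
      using sin_pos[OF y]
      by (auto intro!: derivative_eq_intros simp: power2_eq_square divide_simps) (use sc in algebra)
  qed
  have mem: "x \<in> {0<..<1}" using x by simp
  show ?thesis
  proof (rule DERIV_unique_on_open[OF _ _ open_greaterThanLessThan mem 1])
    show "((\<lambda>z. Polygamma 1 z + Polygamma 1 (1 - z)) has_field_derivative Polygamma 2 x - Polygamma 2 (1 - x)) (at x)"
      using x by (auto intro!: derivative_eq_intros nonpos simp: numeral_2_eq_2)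
    show "((\<lambda>z. pi\<^sup>2 / sin (pi * z) ^ 2) has_field_derivative - 2 * pi ^ 3 * cos (pi * x) / sin (pi * x) ^ 3) (at x)"
      using sin_pos[OF mem]
      by (auto intro!: derivative_eq_intros simp: power2_eq_square power3_eq_cube divide_simps)
  qed
qed

text \<open>
  Up to the factor \<open>27\<close> the left-hand side is \<open>L(3, \<chi>)\<close> for the odd Dirichlet character modulo
  \<open>3\<close>.  The two series are tetragamma values at \<open>1/3\<close> and \<open>1 - 1/3\<close>, and the reflection formula
  evaluates exactly their difference.
\<close>
lemma sums_inverse_cubes_mod_3:
  "(\<lambda>n. 1 / (real n + 1 / 3) ^ 3 - 1 / (real n + 2 / 3) ^ 3) sums (4 * pi ^ 3 / (3 * sqrt 3))"
proof -
  have *: "(\<lambda>n. 1 / (real n + x) ^ 3) sums - (Polygamma 2 x / 2)" if "x > 0" for x :: real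
    using Polygamma_LIMSEQ[of x 2] that
    by (simp add: inverse_eq_divide add_ac numeral_2_eq_2 numeral_3_eq_3)
  have "sqrt 3 ^ 3 = 3 * sqrt 3" by (simp add: power3_eq_cube)
  then have diff: "Polygamma 2 (1 / 3) - Polygamma 2 (2 / 3 :: real) = - 8 * pi ^ 3 / (3 * sqrt 3)"
    using Polygamma_2_reflection_real[of "1 / 3"]
    by (simp add: cos_60 sin_60 power_divide field_simps)
  have "(\<lambda>n. 1 / (real n + 1 / 3) ^ 3 - 1 / (real n + 2 / 3) ^ 3) sums
          (- (Polygamma 2 (1 / 3) / 2) - - (Polygamma 2 (2 / 3) / 2))"
    by (intro sums_diff *) auto
  also have "- (Polygamma 2 (1 / 3) / 2) - - (Polygamma 2 (2 / 3) / 2) =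
      - (Polygamma 2 (1 / 3) - Polygamma 2 (2 / 3 :: real)) / 2" by simp
  finally show ?thesis by (simp add: diff)
qed

section \<open>The integral with a squared logarithm\<close>

text \<open>
  Multiplying numerator and denominator by \<open>1 - x\<^sup>2\<close> turns the denominator into \<open>1 - x\<^sup>6\<close>.  The
  terms \<open>x\<^sup>6\<^sup>n\<^sup>+\<^sup>1\<close> and \<open>x\<^sup>6\<^sup>n\<^sup>+\<^sup>3\<close> are kept together in pairs, which makes the summands
  nonnegative.
\<close>
lemma integral_ln_squared:
  "((\<lambda>x::real. (ln x)\<^sup>2 * (2 * x / (1 + x\<^sup>2 + x ^ 4))) has_integral 2 * pi ^ 3 / (81 * sqrt 3)) {0..1}"
proof (rule has_integral_sums_nonneg)
  show "((\<lambda>x::real. 2 * ((ln x)\<^sup>2 * x ^ (6 * n + 1) - (ln x)\<^sup>2 * x ^ (6 * n + 3))) has_integral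
      2 * (2 / real (6 * n + 1 + 1) ^ 3 - 2 / real (6 * n + 3 + 1) ^ 3)) {0..1}" for n
    by (intro has_integral_mult_right has_integral_diff has_integral_ln_squared_times_power)
next
  fix n and x :: real assume x: "x \<in> {0..1}"
  then have "x ^ (6 * n + 3) \<le> x ^ (6 * n + 1)" by (intro power_decreasing) auto
  then show "0 \<le> 2 * ((ln x)\<^sup>2 * x ^ (6 * n + 1) - (ln x)\<^sup>2 * x ^ (6 * n + 3))"
    by (simp add: mult_left_mono)
next
  fix x :: real assume x: "x \<in> {0..1}"
  show "(\<lambda>n. 2 * ((ln x)\<^sup>2 * x ^ (6 * n + 1) - (ln x)\<^sup>2 * x ^ (6 * n + 3))) sums
          ((ln x)\<^sup>2 * (2 * x / (1 + x\<^sup>2 + x ^ 4)))"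
  proof (cases "x = 1 \<or> x = 0")
    case True
    then show ?thesis by auto
  next
    case False
    then have lt: "x ^ 6 < 1" "x ^ 6 > 0" "x\<^sup>2 < 1" using x by (auto simp: power_less_one_iff)
    then have "(\<lambda>n. (x ^ 6) ^ n) sums (1 / (1 - x ^ 6))" by (intro geometric_sums) auto
    then have "(\<lambda>n. (ln x)\<^sup>2 * (2 * x) * (1 - x\<^sup>2) * (x ^ 6) ^ n) sums
      ((ln x)\<^sup>2 * (2 * x) * (1 - x\<^sup>2) * (1 / (1 - x ^ 6)))" by (rule sums_mult)
    moreover have "(ln x)\<^sup>2 * (2 * x) * (1 - x\<^sup>2) * (x ^ 6) ^ n =
        2 * ((ln x)\<^sup>2 * x ^ (6 * n + 1) - (ln x)\<^sup>2 * x ^ (6 * n + 3))" for n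
      unfolding power_add power_mult by (simp add: algebra_simps power2_eq_square power3_eq_cube)
    moreover have "1 - x ^ 6 = (1 - x\<^sup>2) * (1 + x\<^sup>2 + x ^ 4)"
      by algebra
    then have "(ln x)\<^sup>2 * (2 * x) * (1 - x\<^sup>2) * (1 / (1 - x ^ 6)) = (ln x)\<^sup>2 * (2 * x / (1 + x\<^sup>2 + x ^ 4))"
      using lt by simp
    ultimately show ?thesis by simp
  qed
next
  have "(\<lambda>n. 1 / 54 * (1 / (real n + 1 / 3) ^ 3 - 1 / (real n + 2 / 3) ^ 3)) sums
          (1 / 54 * (4 * pi ^ 3 / (3 * sqrt 3)))"
    by (intro sums_mult sums_inverse_cubes_mod_3)
  moreover have "(\<lambda>n. 2 * (2 / real (6 * n + 1 + 1) ^ 3 - 2 / real (6 * n + 3 + 1) ^ 3)) =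
      (\<lambda>n. 1 / 54 * (1 / (real n + 1 / 3) ^ 3 - 1 / (real n + 2 / 3) ^ 3))"
  proof
    fix n
    have "real (6 * n + 1 + 1) = 6 * (real n + 1 / 3)" "real (6 * n + 3 + 1) = 6 * (real n + 2 / 3)"
      by simp_all
    then have "real (6 * n + 1 + 1) ^ 3 = 216 * (real n + 1 / 3) ^ 3"
              "real (6 * n + 3 + 1) ^ 3 = 216 * (real n + 2 / 3) ^ 3"
      by (simp_all only: power_mult_distrib) simp_all
    then show "2 * (2 / real (6 * n + 1 + 1) ^ 3 - 2 / real (6 * n + 3 + 1) ^ 3) =
      1 / 54 * (1 / (real n + 1 / 3) ^ 3 - 1 / (real n + 2 / 3) ^ 3)" by (simp only:) simp
  qed
  ultimately show "(\<lambda>n. 2 * (2 / real (6 * n + 1 + 1) ^ 3 - 2 / real (6 * n + 3 + 1) ^ 3)) sums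
      (2 * pi ^ 3 / (81 * sqrt 3))" by (simp only:) simp
qed

section \<open>The rational kernel and its poles\<close>

text \<open>
  The logarithmic derivative of \<open>(w\<^sup>2 - w + 1)/(w - 1)\<close>.
\<close>
definition dlog_kernel :: "complex \<Rightarrow> complex" where
  "dlog_kernel w = (2 * w - 1) / (w\<^sup>2 - w + 1) - 1 / (w - 1)"

text \<open>
  The primitive sixth root of unity \<open>\<rho> = e\<^sup>i\<^sup>\<pi>\<^sup>/\<^sup>3\<close>, a zero of \<open>w\<^sup>2 - w + 1\<close>.
\<close>
definition sixth_root :: complex where
  "sixth_root = Complex (1 / 2) (sqrt 3 / 2)"

lemma sixth_root_simps:
  "Re sixth_root = 1 / 2" "Im sixth_root = sqrt 3 / 2" 
  by (simp_all add: sixth_root_def)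

lemma sixth_root_squared: "sixth_root\<^sup>2 = sixth_root - 1"
  by (simp add: complex_eq_iff power2_eq_square sixth_root_simps)

lemma cnj_sixth_root: "cnj sixth_root = 1 - sixth_root"
  by (simp add: complex_eq_iff sixth_root_simps)

lemma sixth_root_factor: "w\<^sup>2 - w + 1 = (w - sixth_root) * (w - cnj sixth_root)"
  unfolding cnj_sixth_root using sixth_root_squared by algebra

lemma sixth_root_eq_exp: "sixth_root = exp (\<i> * of_real (pi / 3))"
  by (simp add: sixth_root_def complex_eq_iff Re_exp Im_exp cos_60 sin_60)

section \<open>The arc and the ray\<close>

lemma Ln_polar:
  assumes "r > 0" "- pi < t" "t \<le> pi"
  shows "Ln (of_real r * exp (\<i> * of_real t)) = of_real (ln r) + \<i> * of_real t"
proof (rule Ln_unique)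
  show "exp (of_real (ln r) + \<i> * of_real t) = of_real r * exp (\<i> * of_real t)"
    using assms by (simp add: exp_add exp_of_real)
qed (use assms in auto)

text \<open>
  The point \<open>x e\<^sup>i\<^sup>\<theta>\<close> with \<open>x = 2 cos \<theta>\<close>, in Cartesian coordinates.  For \<open>|x| \<le> 2\<close> it
  lies on the circle of radius \<open>1\<close> about \<open>1\<close>.
\<close>
definition arc_point :: "real \<Rightarrow> complex" where
  "arc_point x = Complex (x\<^sup>2 / 2) (x * sqrt (1 - (x / 2)\<^sup>2))"

lemma arc_point_polar:
  assumes "\<bar>x\<bar> \<le> 2"
  shows "arc_point x = of_real x * exp (\<i> * of_real (arccos (x / 2)))"
  using assms by (simp add: arc_point_def sin_arccos complex_eq_iff power2_eq_square
      flip: cis_conv_exp)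

text \<open>
  By \<open>x = 2 cos \<theta>\<close>, the point \<open>x e\<^sup>i\<^sup>\<theta>\<close> and its conjugate have both sum and product equal to
  \<open>x\<^sup>2\<close>.
\<close>
lemma arc_point_quadratic:
  assumes "\<bar>x\<bar> \<le> 2"
  shows "(arc_point x)\<^sup>2 - of_real (x\<^sup>2) * arc_point x + of_real (x\<^sup>2) = 0"
proof -
  have "(x / 2)\<^sup>2 \<le> 1" using assms by (simp add: abs_square_le_1)
  then have s: "(sqrt (1 - (x / 2)\<^sup>2))\<^sup>2 = 1 - (x / 2)\<^sup>2" by simp
  define s where "s = sqrt (1 - (x / 2)\<^sup>2)"
  have "s * s = 1 - x * x / 4" using s by (simp add: s_def power2_eq_square)
  then have "4 * s * s = 4 - x * x" by simp
  then show ?thesis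
    unfolding arc_point_def s_def[symmetric]
    by (intro complex_eqI; simp add: power2_eq_square; algebra)
qed

text \<open>
  The relation for \<open>w'\<close> is what implicit differentiation of the quadratic equation gives.
\<close>
lemma arc_point_has_derivative:
  assumes "\<bar>x\<bar> < 2"
  obtains w' where "(arc_point has_vector_derivative w') (at x)"
    "w' * (2 * arc_point x - of_real (x\<^sup>2)) = of_real (2 * x) * (arc_point x - 1)"
proof -
  have x: "(x / 2)\<^sup>2 < 1" using assms by (simp add: abs_square_less_1)
  define s where "s = sqrt (1 - (x / 2)\<^sup>2)"
  have s: "s > 0" "s * s = 1 - x * x / 4" using x by (auto simp: s_def power2_eq_square)
  define w' where "w' = Complex x (s - x\<^sup>2 / (4 * s))"
  have re: "((\<lambda>x. x\<^sup>2 / 2) has_field_derivative x) (at x)"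
    by (auto intro!: derivative_eq_intros)
  have im: "((\<lambda>x. x * sqrt (1 - (x / 2)\<^sup>2)) has_field_derivative (s - x\<^sup>2 / (4 * s))) (at x)"
  proof -
    have "((\<lambda>x. 1 - (x / 2)\<^sup>2) has_field_derivative - x / 2) (at x)"
      by (auto intro!: derivative_eq_intros)
    from DERIV_chain2[OF DERIV_real_sqrt this] x
    have "((\<lambda>x. sqrt (1 - (x / 2)\<^sup>2)) has_field_derivative - x / (4 * s)) (at x)"
      by (simp add: s_def field_simps)
    from DERIV_mult[OF DERIV_ident this] show ?thesis
      by (simp add: s_def power2_eq_square algebra_simps)
  qed
  have "(arc_point has_vector_derivative w') (at x)"
    using re im unfolding arc_point_def w'_def
    by (simp add: has_vector_derivative_complex_iff)
  moreover have "w' * (2 * arc_point x - of_real (x\<^sup>2)) = of_real (2 * x) * (arc_point x - 1)"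
    unfolding w'_def arc_point_def s_def[symmetric] using s
    by (intro complex_eqI; simp add: power2_eq_square divide_simps; algebra)
  ultimately show ?thesis using that by blast
qed

text \<open>
  On the curve \<open>w\<^sup>2 - c w + c = 0\<close> the function \<open>(w\<^sup>2 - w + 1)/(w - 1)\<close> equals \<open>c - 1\<close>.  For
  \<open>c = x\<^sup>2\<close> the factor \<open>2w - c\<close> cancels the one in the derivative of the arc.
\<close>
lemma dlog_kernel_on_arc:
  assumes "w\<^sup>2 - c * w + c = 0" "c \<noteq> 1" "w \<noteq> 1"
  shows "dlog_kernel w * (c - 1) * (w - 1) = 2 * w - c"
proof -
  have q: "w\<^sup>2 - w + 1 = (c - 1) * (w - 1)" using assms(1) by algebra
  have "((2 * w - 1) / (a * b) - 1 / b) * a * b = 2 * w - 1 - a" if "a \<noteq> 0" "b \<noteq> 0" for a b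
    using that by (simp add: field_simps)
  from this[of "c - 1" "w - 1"] show ?thesis
    unfolding dlog_kernel_def q using assms(2,3) by simp
qed

text \<open>
  With \<open>w = r\<rho>\<close> and \<open>\<rho>\<^sup>3 = -1\<close>, expanding \<open>(w\<^sup>2 - w + 1)/(w - 1)\<close> by \<open>w + 1\<close> gives
  \<open>(1 - r\<^sup>3)/(r\<^sup>2\<rho>\<^sup>2 - 1)\<close>; the right-hand side is its logarithmic derivative in \<open>r\<close>, the
  second fraction being extended by \<open>1 - r\<^sup>2/\<rho>\<^sup>2\<close> to give its denominator real coefficients.
\<close>
lemma dlog_kernel_on_ray:
  fixes r :: complex
  assumes "r ^ 6 \<noteq> 1"
  shows "dlog_kernel (r * sixth_root) * sixth_root =
           - (3 * r\<^sup>2 / (1 - r ^ 3)) + (2 * r * sixth_root\<^sup>2 - 2 * r ^ 3) / (1 + r\<^sup>2 + r ^ 4)"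
proof -
  define p where "p = sixth_root"
  have p: "p\<^sup>2 = p - 1" by (simp add: p_def sixth_root_squared)
  define X Y where "X = 1 - r ^ 3" and "Y = 1 + r\<^sup>2 + r ^ 4"
  \<comment> \<open>Clearing denominators reduces everything to polynomial identities modulo \<open>p\<^sup>2 = p - 1\<close>.\<close>
  have "X * (1 + r ^ 3) = 1 - r ^ 6" "Y * (1 - r\<^sup>2) = 1 - r ^ 6"
    unfolding X_def Y_def by algebra+
  then have nz: "X \<noteq> 0" "Y \<noteq> 0" using assms by auto
  have A: "((r * p)\<^sup>2 - r * p + 1) * (r * p + 1) = X"
    and B: "(r * p - 1) * ((r * p + 1) * (1 + r\<^sup>2 * p)) = - Y"
    unfolding X_def Y_def using p by algebra+
  from A B nz have fac: "r * p + 1 \<noteq> 0" "(r * p)\<^sup>2 - r * p + 1 \<noteq> 0" "r * p - 1 \<noteq> 0"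
    "1 + r\<^sup>2 * p \<noteq> 0" by auto
  have "(2 * (r * p) - 1) / ((r * p)\<^sup>2 - r * p + 1) = (2 * (r * p) - 1) * (r * p + 1) / X"
    unfolding A[symmetric] using fac by (intro nonzero_mult_divide_mult_cancel_right[symmetric])
  moreover have "1 / (r * p - 1) = - ((r * p + 1) * (1 + r\<^sup>2 * p) / Y)"
  proof -
    have "Y = - ((r * p - 1) * ((r * p + 1) * (1 + r\<^sup>2 * p)))" using B by simp
    then show ?thesis using fac by simp
  qed
  ultimately have "dlog_kernel (r * p) * p =
      p * (2 * (r * p) - 1) * (r * p + 1) / X + p * (r * p + 1) * (1 + r\<^sup>2 * p) / Y"
    by (simp add: dlog_kernel_def algebra_simps)
  also have "\<dots> = - 3 * r\<^sup>2 / X + (2 * r * p\<^sup>2 - 2 * r ^ 3) / Y"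
  proof -
    have "p * (2 * (r * p) - 1) * (r * p + 1) * Y + p * (r * p + 1) * (1 + r\<^sup>2 * p) * X =
        - 3 * r\<^sup>2 * Y + (2 * r * p\<^sup>2 - 2 * r ^ 3) * X"
      unfolding X_def Y_def using p by algebra
    then show ?thesis using nz by (simp only: add_frac_eq not_False_eq_True)
  qed
  finally show ?thesis by (simp add: p_def X_def Y_def)
qed

abbreviation contour_integrand :: "complex \<Rightarrow> complex" where
  "contour_integrand w \<equiv> ((Ln w)\<^sup>2 + of_real (pi\<^sup>2 / 9)) * dlog_kernel w"

section \<open>A primitive in the upper half plane\<close>

text \<open>
  The only pole of the kernel in the upper half plane is \<open>\<rho>\<close>, and it is simple; the logarithmic
  factor vanishes there because \<open>Ln \<rho> = i\<pi>/3\<close>.  The integrand thus extends holomorphically to a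
  convex domain.
\<close>
lemma contour_integrand_primitive:
  obtains G where "\<And>w. Im w > 0 \<Longrightarrow> G field_differentiable at w"
    "\<And>w. Im w > 0 \<Longrightarrow> w \<noteq> sixth_root \<Longrightarrow>
       (G has_field_derivative contour_integrand w) (at w)"
proof -
  define H where "H = {w. Im w > 0}"
  have H: "convex H" "open H" by (auto simp: H_def convex_halfspace_Im_gt open_halfspace_Im_gt)
  have H_nonneg: "w \<notin> \<real>\<^sub>\<le>\<^sub>0" "w \<noteq> 1" "w \<noteq> cnj sixth_root" if "w \<in> H" for w
    using that by (auto simp: H_def complex_nonpos_Reals_iff sixth_root_simps)
  define f where "f = (\<lambda>w. (Ln w)\<^sup>2 + of_real (pi\<^sup>2 / 9))"
  have f_hol: "f holomorphic_on H" unfolding f_def by (intro holomorphic_intros) (auto dest: H_nonneg)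
  have "Ln sixth_root = \<i> * of_real (pi / 3)"
    using Ln_polar[of 1 "pi / 3"] by (simp add: sixth_root_eq_exp)
  then have f0: "f sixth_root = 0" by (simp only: f_def) (simp add: power_mult_distrib power_divide)
  \<comment> \<open>The difference quotient of \<open>f\<close> at its zero \<open>\<rho>\<close> absorbs the pole of the kernel.\<close>
  define q where "q = (\<lambda>w. if w = sixth_root then deriv f sixth_root
      else (f w - f sixth_root) / (w - sixth_root))"
  define g where "g = (\<lambda>w. q w + f w * (1 / (w - cnj sixth_root) - 1 / (w - 1)))"
  have "q holomorphic_on H" unfolding q_def using f_hol H(2) by (rule pole_lemma_open)
  then have "g holomorphic_on H" unfolding g_def
    by (intro holomorphic_intros f_hol) (auto dest: H_nonneg)
  then obtain G where G: "\<And>w. w \<in> H \<Longrightarrow> (G has_field_derivative g w) (at w within H)"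
    using holomorphic_convex_primitive'[OF H] by metis
  have G': "(G has_field_derivative g w) (at w)" if "w \<in> H" for w
    using G[OF that] at_within_open[OF that H(2)] by simp
  have "g w = f w * dlog_kernel w" if "w \<in> H" "w \<noteq> sixth_root" for w
  proof -
    have nz: "w - sixth_root \<noteq> 0" "w - cnj sixth_root \<noteq> 0" using H_nonneg[OF that(1)] that(2) by auto
    have "(2 * w - 1) / (w\<^sup>2 - w + 1) = 1 / (w - sixth_root) + 1 / (w - cnj sixth_root)"
      unfolding sixth_root_factor using nz by (simp add: cnj_sixth_root add_frac_eq del: right_minus_eq)
    then show ?thesis using that(2)
      by (simp add: g_def q_def f0 dlog_kernel_def algebra_simps)
  qed
  with G' show ?thesis
    using that[of G] unfolding H_def f_def field_differentiable_def by force
qed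

text \<open>
  The three poles \<open>1\<close>, \<open>\<rho>\<close> and its conjugate all have modulus \<open>1\<close>.
\<close>
lemma norm_dlog_kernel_le:
  assumes "norm w \<le> 1 / 2"
  shows "norm (dlog_kernel w) \<le> 10"
proof -
  have "norm (w - 1) \<ge> 1 / 2" using norm_triangle_ineq2[of 1 w] assms by (simp add: norm_minus_commute)
  then have "norm (1 / (w - 1)) \<le> 1 / (1 / 2)" unfolding norm_divide by (intro frac_le) auto
  then have 1: "norm (1 / (w - 1)) \<le> 2" by simp
  have "norm (w\<^sup>2 - w) \<le> norm w ^ 2 + norm w"
    using norm_triangle_ineq4[of "w\<^sup>2" w] by (simp add: norm_power)
  also have "\<dots> \<le> (1 / 2)\<^sup>2 + 1 / 2" using assms by (intro add_mono power_mono) auto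
  finally have le: "norm (w - w\<^sup>2) \<le> 3 / 4" by (simp add: power2_eq_square norm_minus_commute)
  have "norm (w\<^sup>2 - w + 1) = norm (1 - (w - w\<^sup>2))" by (simp add: algebra_simps)
  also have "\<dots> \<ge> norm (1::complex) - norm (w - w\<^sup>2)" by (rule norm_triangle_ineq2)
  finally have "norm (w\<^sup>2 - w + 1) \<ge> 1 / 4" using le by simp
  moreover have "norm (2 * w - 1) \<le> 2"
    using norm_triangle_ineq4[of "2 * w" 1] assms by (simp add: norm_mult)
  ultimately have "norm ((2 * w - 1) / (w\<^sup>2 - w + 1)) \<le> 2 / (1 / 4)"
    unfolding norm_divide by (intro frac_le) auto
  then show ?thesis unfolding dlog_kernel_def
    using norm_triangle_ineq4[of "(2 * w - 1) / (w\<^sup>2 - w + 1)" "1 / (w - 1)"] 1 by simp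
qed


text \<open>
  Both points lie in the convex set of all \<open>w\<close> with \<open>|w| \<le> x\<close> and \<open>Im w \<ge> x/2\<close>.  The lower bound
  on \<open>Im w\<close> keeps this set away from the singularity of the logarithm, so the mean value
  inequality applies; its bound tends to \<open>0\<close> with \<open>x\<close>.
\<close>
lemma primitive_gap_bound:
  assumes G: "\<And>w. Im w > 0 \<Longrightarrow> w \<noteq> sixth_root \<Longrightarrow>
       (G has_field_derivative contour_integrand w) (at w)"
    and x: "0 < x" "x \<le> 1 / 2"
    and u: "Im u \<ge> x / 2" "norm u \<le> x" and v: "Im v \<ge> x / 2" "norm v \<le> x"
  shows "norm (G u - G v) \<le> ((pi - ln (x / 2))\<^sup>2 + pi\<^sup>2 / 9) * 10 * (2 * x)"
proof -
  define S where "S = {w. Im w \<ge> x / 2} \<inter> cball 0 x"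
  have "norm (G u - G v) \<le> ((pi - ln (x / 2))\<^sup>2 + pi\<^sup>2 / 9) * 10 * norm (u - v)"
  proof (rule field_differentiable_bound)
    show "convex S" unfolding S_def
      by (intro convex_Int convex_halfspace_Im_ge convex_cball)
    show "u \<in> S" "v \<in> S" using u v by (auto simp: S_def)
  next
    fix w assume "w \<in> S"
    then have w: "Im w \<ge> x / 2" "norm w \<le> x" by (auto simp: S_def)
    have "w \<noteq> sixth_root"
    proof
      assume "w = sixth_root"
      then have "norm w = 1" by (simp add: sixth_root_eq_exp)
      then show False using w x by simp
    qed
    with G[of w] w x show "(G has_field_derivative contour_integrand w) (at w within S)"
      by (auto intro: has_field_derivative_at_within)
    have w0: "w \<noteq> 0" using w x by auto
    have "norm w \<ge> x / 2" using w abs_Im_le_cmod[of w] by simp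
    then have "ln (norm w) \<ge> ln (x / 2)" "ln (norm w) \<le> 0" using w x w0 by auto
    then have "\<bar>Re (Ln w)\<bar> \<le> - ln (x / 2)" using w0 by simp
    moreover have "\<bar>Im (Ln w)\<bar> \<le> pi" using Im_Ln_le_pi[OF w0] mpi_less_Im_Ln[OF w0] by auto
    ultimately have "norm (Ln w) \<le> pi - ln (x / 2)" using cmod_le[of "Ln w"] by linarith
    then have "norm ((Ln w)\<^sup>2) \<le> (pi - ln (x / 2))\<^sup>2"
      unfolding norm_power by (intro power_mono) auto
    moreover have "norm (complex_of_real (pi\<^sup>2 / 9)) = pi\<^sup>2 / 9" by (simp only: norm_of_real) simp
    ultimately have "norm ((Ln w)\<^sup>2 + of_real (pi\<^sup>2 / 9)) \<le> (pi - ln (x / 2))\<^sup>2 + pi\<^sup>2 / 9"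
      by (metis add_mono norm_triangle_le order_refl)
    moreover have "norm (dlog_kernel w) \<le> 10" using w x by (intro norm_dlog_kernel_le) auto
    ultimately show "norm (contour_integrand w) \<le>
        ((pi - ln (x / 2))\<^sup>2 + pi\<^sup>2 / 9) * 10"
      unfolding norm_mult by (intro mult_mono) auto
  qed
  also have "\<dots> \<le> ((pi - ln (x / 2))\<^sup>2 + pi\<^sup>2 / 9) * 10 * (2 * x)"
    using norm_triangle_ineq4[of u v] u v by (intro mult_left_mono) auto
  finally show ?thesis .
qed

section \<open>Replacing the arc by the ray\<close>

lemma arc_point_pos:
  assumes "0 < x" "x \<le> 1"
  shows "norm (arc_point x) = x" "Im (arc_point x) \<ge> x / 2" "x < 1 \<Longrightarrow> arc_point x \<noteq> sixth_root"
    "Ln (arc_point x) = of_real (ln x) + \<i> * of_real (arccos (x / 2))"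
proof -
  have polar: "arc_point x = of_real x * exp (\<i> * of_real (arccos (x / 2)))"
    using assms by (intro arc_point_polar) auto
  then show n: "norm (arc_point x) = x" using assms by (simp add: norm_mult)
  show "arc_point x \<noteq> sixth_root" if "x < 1"
  proof
    assume "arc_point x = sixth_root"
    then have "norm (arc_point x) = 1" by (simp add: sixth_root_eq_exp)
    then show False using n that by simp
  qed
  have "(x / 2)\<^sup>2 \<le> (1 / 2)\<^sup>2" using assms by (intro power_mono) auto
  then have "sqrt (1 - (x / 2)\<^sup>2) \<ge> 1 / 2" by (intro real_le_rsqrt) (simp add: power2_eq_square)
  then have "x * sqrt (1 - (x / 2)\<^sup>2) \<ge> x * (1 / 2)" using assms by (intro mult_left_mono) auto
  then show "Im (arc_point x) \<ge> x / 2" by (simp add: arc_point_def)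
  have "0 \<le> arccos (x / 2)" "arccos (x / 2) \<le> pi"
    using assms by (auto intro: arccos_lbound arccos_ubound)
  then show "Ln (arc_point x) = of_real (ln x) + \<i> * of_real (arccos (x / 2))"
    unfolding polar using assms by (intro Ln_polar) (auto intro: less_le_trans[of _ 0])
qed

text \<open>
  Along the arc \<open>h(w) dw\<close> is real, namely \<open>2x/(x\<^sup>2 - 1) dx\<close>, so that only the imaginary part
  \<open>2 ln x arccos (x/2)\<close> of \<open>(Ln w)\<^sup>2\<close> contributes.
\<close>
lemma integrand_on_arc:
  assumes x: "0 < x" "x < 1"
  obtains w' where "(arc_point has_vector_derivative w') (at x)"
    "Im (w' * (contour_integrand (arc_point x))) =
       4 * (x * arccos (x / 2) * ln x / (x\<^sup>2 - 1))"
proof -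
  define w where "w = arc_point x"
  obtain w' where w': "(arc_point has_vector_derivative w') (at x)"
    "w' * (2 * w - of_real (x\<^sup>2)) = of_real (2 * x) * (w - 1)"
    using arc_point_has_derivative[of x] x unfolding w_def by auto
  have x2: "x\<^sup>2 < 1" using x by (simp add: power_less_one_iff)
  have w1: "w \<noteq> 1" using arc_point_pos(2)[of x] x by (auto simp: w_def)
  have c: "complex_of_real (x\<^sup>2) \<noteq> 1" using x2 by (metis less_irrefl of_real_eq_1_iff)
  have "w' * dlog_kernel w * (of_real (x\<^sup>2) - 1) * (w - 1) = w' * (2 * w - of_real (x\<^sup>2))"
    using dlog_kernel_on_arc[OF arc_point_quadratic[of x]] c w1 x by (simp add: w_def mult.assoc)
  also have "\<dots> = of_real (2 * x) * (w - 1)" by (rule w'(2))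
  finally have "w' * dlog_kernel w * (of_real (x\<^sup>2) - 1) = of_real (2 * x)" using w1 by simp
  then have "w' * dlog_kernel w = of_real (2 * x) / (of_real (x\<^sup>2) - 1)"
    using c by (simp add: eq_divide_eq)
  then have k: "w' * dlog_kernel w = of_real (2 * x / (x\<^sup>2 - 1))" by simp
  have "Im (w' * (contour_integrand w)) =
      Im (((Ln w)\<^sup>2 + of_real (pi\<^sup>2 / 9)) * (w' * dlog_kernel w))" by (simp add: mult_ac)
  also have "\<dots> = Im ((Ln w)\<^sup>2) * (2 * x / (x\<^sup>2 - 1))"
    unfolding k by (simp del: of_real_divide of_real_mult of_real_diff)
  also have "Im ((Ln w)\<^sup>2) = 2 * ln x * arccos (x / 2)"
    using arc_point_pos(4)[of x] x by (simp add: w_def power2_eq_square)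
  finally show ?thesis using that[OF w'(1)] by (simp add: w_def mult_ac)
qed

text \<open>
  On the ray \<open>(Ln w)\<^sup>2 + \<pi>\<^sup>2/9 = (ln r)\<^sup>2 + (2\<pi>/3) i ln r\<close>, so that \<open>(ln r)\<^sup>2\<close> meets the imaginary
  part of the kernel and \<open>ln r\<close> its real part.  The latter is written as a sum of two terms whose
  power series each have coefficients of one sign.
\<close>
lemma integrand_on_ray:
  assumes r: "0 < r" "r < 1"
  shows "Im (sixth_root * (contour_integrand (of_real r * sixth_root))) =
         (ln r)\<^sup>2 * (2 * r / (1 + r\<^sup>2 + r ^ 4)) * (sqrt 3 / 2) +
         (r * ln r / (r\<^sup>2 - 1) - 3 * (ln r * r\<^sup>2 / (1 - r ^ 6))) * (2 * pi / 3)"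
proof -
  define X Y where "X = 1 - r ^ 3" and "Y = 1 + r\<^sup>2 + r ^ 4"
  have lt: "r ^ 6 < 1" "r ^ 3 < 1" "r\<^sup>2 < 1" using r by (auto simp: power_less_one_iff)
  have Y: "Y > 0" using r by (simp add: Y_def add_pos_pos)
  have X: "X > 0" using lt by (simp add: X_def)
  have "complex_of_real (r ^ 6) \<noteq> 1" using lt by (metis less_irrefl of_real_eq_1_iff)
  then have "dlog_kernel (of_real r * sixth_root) * sixth_root =
      - (3 * (of_real r)\<^sup>2 / (1 - of_real r ^ 3)) +
      (2 * of_real r * sixth_root\<^sup>2 - 2 * of_real r ^ 3) / (1 + (of_real r)\<^sup>2 + of_real r ^ 4)"
    by (intro dlog_kernel_on_ray) simp
  also have "\<dots> = - of_real (3 * r\<^sup>2 / X) + (2 * of_real r * (sixth_root - 1) - of_real (2 * r ^ 3)) / of_real Y"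
    by (simp add: X_def Y_def sixth_root_squared)
  finally have k: "dlog_kernel (of_real r * sixth_root) * sixth_root =
      Complex (- (3 * r\<^sup>2 / X) - (r + 2 * r ^ 3) / Y) (sqrt 3 * r / Y)"
    by (simp add: complex_eq_iff sixth_root_simps add_divide_distrib diff_divide_distrib)
  have "Ln (of_real r * sixth_root) = of_real (ln r) + \<i> * of_real (pi / 3)"
    unfolding sixth_root_eq_exp using r by (intro Ln_polar) auto
  then have L: "(Ln (of_real r * sixth_root))\<^sup>2 + of_real (pi\<^sup>2 / 9) = Complex ((ln r)\<^sup>2) (2 * pi / 3 * ln r)"
    by (simp only:) (simp add: complex_eq_iff power2_eq_square)
  \<comment> \<open>The two terms on the right expand as minus the sum of all \<open>r\<^sup>n\<^sup>-\<^sup>1\<close> with \<open>n\<close> even, and minus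
    three times the sum of those with \<open>n \<equiv> 3\<close> modulo \<open>6\<close>.\<close>
  have rational: "- (3 * r\<^sup>2 / X) - (r + 2 * r ^ 3) / Y = r / (r\<^sup>2 - 1) - 3 * (r\<^sup>2 / (1 - r ^ 6))"
  proof -
    have e: "1 - r ^ 6 = X * (1 + r ^ 3)" "1 - r ^ 6 = Y * (1 - r\<^sup>2)"
      unfolding X_def Y_def by algebra+
    have 1: "3 * r\<^sup>2 / X = 3 * r\<^sup>2 * (1 + r ^ 3) / (1 - r ^ 6)"
      unfolding e(1) using r X by (simp add: add_pos_pos less_imp_neq[symmetric])
    have 2: "(r + 2 * r ^ 3) / Y = (r + 2 * r ^ 3) * (1 - r\<^sup>2) / (1 - r ^ 6)"
      unfolding e(2) using lt Y by simp
    have 3: "r / (r\<^sup>2 - 1) = - (r * Y) / (1 - r ^ 6)"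
      unfolding e(2) using lt Y by (simp add: minus_divide_right)
    have num: "- (3 * r\<^sup>2 * (1 + r ^ 3)) - (r + 2 * r ^ 3) * (1 - r\<^sup>2) = - (r * Y) - 3 * r\<^sup>2"
      unfolding Y_def by algebra
    have "- (3 * r\<^sup>2 / X) - (r + 2 * r ^ 3) / Y =
        (- (3 * r\<^sup>2 * (1 + r ^ 3)) - (r + 2 * r ^ 3) * (1 - r\<^sup>2)) / (1 - r ^ 6)"
      by (simp only: 1 2 diff_divide_distrib minus_divide_left)
    also have "\<dots> = r / (r\<^sup>2 - 1) - 3 * (r\<^sup>2 / (1 - r ^ 6))"
      by (simp only: num 3 diff_divide_distrib times_divide_eq_right)
    finally show ?thesis .
  qed
  have "Im (sixth_root * (contour_integrand (of_real r * sixth_root))) =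
        Im (((Ln (of_real r * sixth_root))\<^sup>2 + of_real (pi\<^sup>2 / 9)) *
              (dlog_kernel (of_real r * sixth_root) * sixth_root))"
    by (simp add: mult_ac)
  also have "\<dots> = (ln r)\<^sup>2 * (sqrt 3 * r / Y) + 2 * pi / 3 * ln r * (r / (r\<^sup>2 - 1) - 3 * (r\<^sup>2 / (1 - r ^ 6)))"
    unfolding k L rational by simp
  finally show ?thesis by (simp add: Y_def algebra_simps)
qed

text \<open>
  Cauchy's theorem for the arc and the ray, stated for the difference of the two integrands.  No
  integrability has to be known beforehand: the difference is the derivative of the gap between
  the values of the primitive at \<open>x e\<^sup>i\<^sup>\<theta>\<close> and at \<open>x \<rho>\<close>, and that gap vanishes at \<open>x = 1\<close>, where
  the points coincide, and tends to \<open>0\<close> as \<open>x \<rightarrow> 0\<close>.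
\<close>
lemma integral_arc_minus_ray:
  "((\<lambda>x. 4 * (x * arccos (x / 2) * ln x / (x\<^sup>2 - 1)) -
      ((ln x)\<^sup>2 * (2 * x / (1 + x\<^sup>2 + x ^ 4)) * (sqrt 3 / 2) +
       (x * ln x / (x\<^sup>2 - 1) - 3 * (ln x * x\<^sup>2 / (1 - x ^ 6))) * (2 * pi / 3)))
     has_integral 0) {0..1}" (is "(?f has_integral 0) _")
proof -
  obtain G where G: "\<And>w. Im w > 0 \<Longrightarrow> G field_differentiable at w"
    "\<And>w. Im w > 0 \<Longrightarrow> w \<noteq> sixth_root \<Longrightarrow>
       (G has_field_derivative contour_integrand w) (at w)"
    using contour_integrand_primitive by blast
  define ray where "ray x = of_real x * sixth_root" for x
  define gap where "gap x = (if x = 0 then 0 else Im (G (arc_point x) - G (ray x)))" for x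
  have ray: "Im (ray x) \<ge> x / 2" "norm (ray x) = x" if "x > 0" for x
    using that by (auto simp: ray_def sixth_root_simps norm_mult)
       (auto simp: sixth_root_eq_exp)
  have contG: "isCont G w" if "Im w > 0" for w
    using G(1)[OF that] by (rule field_differentiable_imp_continuous_at)
  have "(?f has_integral (gap 1 - gap 0)) {0..1}"
  proof (rule fundamental_theorem_of_calculus_interior)
    show "continuous_on {0..1} gap"
      unfolding continuous_on_def
    proof
      fix x :: real assume x: "x \<in> {0..1}"
      show "(gap \<longlongrightarrow> gap x) (at x within {0..1})"
      proof (cases "x = 0")
        case True
        have "(gap \<longlongrightarrow> 0) (at_right 0)"
        proof (rule Lim_null_comparison)
          show "((\<lambda>x. ((pi - ln (x / 2))\<^sup>2 + pi\<^sup>2 / 9) * 10 * (2 * x)) \<longlongrightarrow> 0) (at_right 0)"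
            by real_asymp
          have "norm (gap y) \<le> ((pi - ln (y / 2))\<^sup>2 + pi\<^sup>2 / 9) * 10 * (2 * y)"
            if y: "y \<in> {0<..<1/2}" for y
          proof -
            have "norm (gap y) \<le> norm (G (arc_point y) - G (ray y))"
              using y abs_Im_le_cmod by (simp add: gap_def del: minus_complex.sel)
            also have "\<dots> \<le> ((pi - ln (y / 2))\<^sup>2 + pi\<^sup>2 / 9) * 10 * (2 * y)"
              using y arc_point_pos(1,2)[of y] ray[of y]
              by (intro primitive_gap_bound G(2)) auto
            finally show ?thesis .
          qed
          then show "\<forall>\<^sub>F y in at_right 0. norm (gap y) \<le> ((pi - ln (y / 2))\<^sup>2 + pi\<^sup>2 / 9) * 10 * (2 * y)"
            by (intro eventually_at_rightI[of 0 "1/2"]) auto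
        qed
        then show ?thesis using True by (simp add: gap_def at_within_Icc_at_right)
      next
        case False
        then have x: "0 < x" "x \<le> 1" using x by auto
        obtain w' where "(arc_point has_vector_derivative w') (at x)"
          using arc_point_has_derivative[of x] x by auto
        then have "isCont arc_point x" by (rule has_vector_derivative_continuous)
        moreover have "isCont G (arc_point x)" using arc_point_pos(2)[of x] x by (intro contG) auto
        ultimately have 1: "isCont (\<lambda>y. G (arc_point y)) x" by (rule isCont_o2)
        have "isCont ray x" unfolding ray_def by (intro continuous_intros)
        moreover have "isCont G (ray x)" using ray(1)[of x] x by (intro contG) auto
        ultimately have 2: "isCont (\<lambda>y. G (ray y)) x" by (rule isCont_o2)
        have "isCont (\<lambda>y. Im (G (arc_point y) - G (ray y))) x"
          using 1 2 by (intro isCont_Im isCont_diff)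
        moreover have "\<forall>\<^sub>F y in nhds x. gap y = Im (G (arc_point y) - G (ray y))"
          by (rule eventually_mono[OF eventually_nhds_in_open[OF open_greaterThan, of x 0]])
            (use x in \<open>auto simp: gap_def\<close>)
        ultimately have "isCont gap x" by (simp add: isCont_cong)
        then show ?thesis by (simp add: isCont_def tendsto_within_subset[of _ _ _ UNIV])
      qed
    qed
  next
    fix x :: real assume "x \<in> {0<..<1}"
    then have x: "0 < x" "x < 1" by auto
    obtain w' where w': "(arc_point has_vector_derivative w') (at x)"
      and im: "Im (w' * (contour_integrand (arc_point x))) =
       4 * (x * arccos (x / 2) * ln x / (x\<^sup>2 - 1))"
      using integrand_on_arc[OF x] by blast
    have ray': "(ray has_vector_derivative sixth_root) (at x)"
      unfolding ray_def by (auto intro!: derivative_eq_intros)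
    have "norm sixth_root = 1" by (simp add: sixth_root_eq_exp)
    then have "ray x \<noteq> sixth_root" using ray(2)[of x] x by auto
    then have "((G \<circ> ray) has_vector_derivative
        sixth_root * (contour_integrand (ray x))) (at x)"
      using ray(1)[of x] x by (intro field_vector_diff_chain_at ray' G(2)) auto
    moreover have "((G \<circ> arc_point) has_vector_derivative
        w' * (contour_integrand (arc_point x))) (at x)"
      using arc_point_pos(2,3)[of x] x by (intro field_vector_diff_chain_at w' G(2)) auto
    ultimately have "((\<lambda>y. (G \<circ> arc_point) y - (G \<circ> ray) y) has_vector_derivative
        w' * (contour_integrand (arc_point x)) -
        sixth_root * (contour_integrand (ray x))) (at x)"
      by (intro has_vector_derivative_diff)
    from bounded_linear.has_vector_derivative[OF bounded_linear_Im this]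
    have "((\<lambda>y. Im (G (arc_point y) - G (ray y))) has_vector_derivative ?f x) (at x)"
      using im integrand_on_ray[OF x] by (simp add: ray_def)
    then show "(gap has_vector_derivative ?f x) (at x)"
      by (rule has_vector_derivative_transform_within_open[of _ _ _ "{0<..}"]) (use x in \<open>auto simp: gap_def\<close>)
  qed auto
  moreover have "arc_point 1 = sixth_root"
    by (simp add: arc_point_def sixth_root_def power2_eq_square real_sqrt_divide)
  then have "gap 1 - gap 0 = 0" by (simp add: gap_def ray_def)
  ultimately show ?thesis by simp
qed

theorem theorem5p0p2:
  shows "((\<lambda>x::real. x * arcsin (x / 2) * ln x / (x\<^sup>2 - 1)) has_integral 5 * pi ^ 3 / 1296) {0..1} \<and>
         ((\<lambda>x::real. x * arccos (x / 2) * ln x / (x\<^sup>2 - 1)) has_integral 11 * pi ^ 3 / 648) {0..1}"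
proof
  let ?R = "\<lambda>x::real. (ln x)\<^sup>2 * (2 * x / (1 + x\<^sup>2 + x ^ 4)) * (sqrt 3 / 2) +
       (x * ln x / (x\<^sup>2 - 1) - 3 * (ln x * x\<^sup>2 / (1 - x ^ 6))) * (2 * pi / 3)"
  have "(?R has_integral 2 * pi ^ 3 / (81 * sqrt 3) * (sqrt 3 / 2) +
      (pi\<^sup>2 / 24 - - (pi\<^sup>2 / 24)) * (2 * pi / 3)) {0..1}"
    by (intro has_integral_add has_integral_mult_left has_integral_diff
        integral_ln_squared integral_x_ln_x integral_x2_ln_x)
  also have "2 * pi ^ 3 / (81 * sqrt 3) * (sqrt 3 / 2) + (pi\<^sup>2 / 24 - - (pi\<^sup>2 / 24)) * (2 * pi / 3) =
      11 * pi ^ 3 / 162"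
    by (simp add: power2_eq_square power3_eq_cube)
  finally have ray: "(?R has_integral 11 * pi ^ 3 / 162) {0..1}" .
  from has_integral_add[OF integral_arc_minus_ray this]
  have "((\<lambda>x. 4 * (x * arccos (x / 2) * ln x / (x\<^sup>2 - 1))) has_integral 11 * pi ^ 3 / 162) {0..1}"
    by simp
  from has_integral_mult_right[OF this, of "1 / 4"]
  show arccos: "((\<lambda>x. x * arccos (x / 2) * ln x / (x\<^sup>2 - 1)) has_integral 11 * pi ^ 3 / 648) {0..1}"
    by simp
  have diff: "((\<lambda>x. pi / 2 * (x * ln x / (x\<^sup>2 - 1)) - x * arccos (x / 2) * ln x / (x\<^sup>2 - 1))
      has_integral pi / 2 * (pi\<^sup>2 / 24) - 11 * pi ^ 3 / 648) {0..1}"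
    by (intro has_integral_diff has_integral_mult_right integral_x_ln_x arccos)
  have val: "pi / 2 * (pi\<^sup>2 / 24) - 11 * pi ^ 3 / 648 = 5 * pi ^ 3 / 1296"
    by (simp add: power2_eq_square power3_eq_cube)
  have eq: "pi / 2 * (x * ln x / (x\<^sup>2 - 1)) - x * arccos (x / 2) * ln x / (x\<^sup>2 - 1) =
      x * arcsin (x / 2) * ln x / (x\<^sup>2 - 1)" if "x \<in> {0..1}" for x :: real
  proof -
    have "arcsin (x / 2) = pi / 2 - arccos (x / 2)"
      using that by (intro arcsin_arccos_eq) auto
    moreover have "k * (x * L / d) - x * a * L / d = x * (k - a) * L / d" for k a L d :: real
      by (simp add: algebra_simps diff_divide_distrib)
    ultimately show ?thesis by (simp only:)
  qed
  show "((\<lambda>x. x * arcsin (x / 2) * ln x / (x\<^sup>2 - 1)) has_integral 5 * pi ^ 3 / 1296) {0..1}"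
    by (rule has_integral_eq[OF eq diff[unfolded val]])
qed

end
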